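(* Let $s<n$ be integers, $X\subseteq\mathbb{R}^n$ closed and convex, $f:\mathbb{R}^n\to\mathbb{R}$ continuously differentiable with Lipschitz continuous gradient on $\mathbb{R}^n$. Let $\mathcal{N}$ be a discrete neighborhood map satisfying the continuity property. Let $\{(x^k,y^k)\}$ be the sequence generated by Algorithm SNS (with neighborhood $\mathcal{N}$) from $y^0\in\mathcal{Y}$, $x^0\in\mathcal{X}(y^0)$ with parameter $\xi>0$, and suppose that the level set $\{(x,y): y\in\mathcal{Y},\ x\in\mathcal{X}(y),\ f(x)\le f(x^0)+\xi\}$ is compact. Let $K_u=\{k\ge 1:\eta_k<\eta_{k-1}\}$. Then every accumulation point $(x^*,y^* )$ of $\{(x^k,y^k)\}_{k\in K_u}$ is such that $x^*$ is an $\mathcal{N}$-stationary point of the problem $\min\{f(x):\|x\|_0\le s,\ x\in X\}$.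
   Context: $\|x\|_0$ is the number of nonzero components of $x$, $e$ is the all-ones vector, $\Pi_C$ is the Euclidean projection onto a nonempty closed convex set $C$. Put $\mathcal{Y}=\{y\in\{0,1\}^n : e^\top y\ge n-s\}$ and $\mathcal{X}(y)=\{x\in X : x_iy_i=0\ \forall i\}$ for $y\in\mathcal{Y}$ (closed and convex). A pair $(x,y)$ is feasible if $y\in\mathcal{Y}$ and $x\in\mathcal{X}(y)$. A sequence $(x^k,y^k)$ converges to $(\bar x,\bar y)$ if $x^k\to\bar x$ and $y^k=\bar y$ for all sufficiently large $k$; accumulation points are limits of convergent subsequences. A discrete neighborhood map $\mathcal{N}$ assigns to every feasible pair $(x,y)$ a finite set $\mathcal{N}(x,y)$ of feasible pairs containing $(x,y)$. Continuity property: whenever a sequence of feasible pairs $(x^k,y^k)$ converges to $(\bar x,\bar y)$, for every $(\hat x,\hat y)\in\mathcal{N}(\bar x,\bar y)$ there is a sequence $(\hat x^k,\hat y^k)\in\mathcal{N}(x^k,y^k)$ converging to $(\hat x,\hat y)$. Stationarity: $\bar x\in\mathcal{X}(\bar y)$ is a stationary point of $\min\{f(x):x\in\mathcal{X}(\bar y)\}$ if $\bar x=\Pi_{\mathcal{X}(\bar y)}[\bar x-\nabla f(\bar x)]$. A point $x^*\in X$ with $\|x^*\|_0\le s$ is $\mathcal{N}$-stationary if there is $y^*\in\mathcal{Y}$ such that (i) $(x^*,y^* )$ is feasible; (ii) $x^*$ is a stationary point of $\min\{f(x):x\in\mathcal{X}(y^* )\}$; (iii) every $(\hat x,\hat y)\in\mathcal{N}(x^*,y^*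 )$ satisfies $f(\hat x)\ge f(x^* )$, and if $f(\hat x)=f(x^* )$ then $\hat x$ is a stationary point of $\min\{f(x):x\in\mathcal{X}(\hat y)\}$. Procedure PGLS$(x,y)$ (fixed constants $\gamma\in(0,\tfrac12)$, $\delta\in(0,1)$): for a feasible pair $(x,y)$ set $d=\Pi_{\mathcal{X}(y)}[x-\nabla f(x)]-x$; let $\alpha$ be the first element of $1,\delta,\delta^2,\dots$ with $f(x+\alpha d)\le f(x)+\gamma\alpha\nabla f(x)^\top d$; return $\tilde x=x+\alpha d$. Algorithm SNS. Inputs: $y^0\in\mathcal{Y}$, $x^0\in\mathcal{X}(y^0)$, $\xi>0$, $\theta\in(0,1)$, $\eta_0>0$, $\mu_0>0$, $\delta'\in(0,1)$. For $k=0,1,2,\dots$ (no stopping rule): Step 1: compute $\tilde x^k$ by PGLS$(x^k,y^k)$. Step 2: let $W_k=\{(x,y)\in\mathcal{N}(\tilde x^k,y^k): f(x)\le f(\tilde x^k)+\xi\}$. 2.1: if $W_k\ne\emptyset$, choose any $(x',y')\in W_k$, set $j=1$, $x^j=x'$ (inner iterates); otherwise go to Step 3. 2.2: compute $x^{j+1}$ by PGLS$(x^j,y')$. 2.3: if $f(x^{j+1})\le f(\tilde x^k)-\eta_k$, set $x^{k+1}=x^{j+1}$, $y^{k+1}=y'$, $\eta_{k+1}=\eta_k$ and go to Step 4. 2.4: if $\|x^j-\Pi_{\mathcal{X}(y')}[x^j-\nabla f(x^j)]\|>\|x^k-\Pi_{\mathcal{X}(y^k)}[x^k-\nabla f(x^k)]\|+\mu_k$,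 set $j=j+1$ and go to 2.2; otherwise remove $(x',y')$ from $W_k$ and go to 2.1. Step 3: set $x^{k+1}=\tilde x^k$, $y^{k+1}=y^k$; if $f(x^{k+1})\le f(x^k)-\eta_k$ set $\eta_{k+1}=\eta_k$, otherwise $\eta_{k+1}=\theta\eta_k$. Step 4: set $\mu_{k+1}=\delta'\mu_k$ and pass to iteration $k+1$. *)

theory Defs
  imports "HOL-Analysis.Analysis"
begin

section \<open>Gradient, cardinality, feasible pairs\<close>

definition grad :: "('a::real_inner \<Rightarrow> real) \<Rightarrow> 'a \<Rightarrow> 'a" where
  "grad f x = (THE D. GDERIV f x :> D)"

lemma grad_eqI:
  assumes "GDERIV f x :> D"
  shows "grad f x = D"
  unfolding grad_def
proof (rule the_equality)
  show "GDERIV f x :> D" by fact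
next
  fix E
  assume "GDERIV f x :> E"
  then have "(\<lambda>h. inner h E) = (\<lambda>h. inner h D)"
    using assms has_derivative_unique unfolding gderiv_def by blast
  then have "inner (E - D) (E - D) = 0"
    by (metis inner_diff_right right_minus_eq)
  then show "E = D" by simp
qed

lemma GDERIV_grad:
  fixes f :: "'a::euclidean_space \<Rightarrow> real"
  assumes "f differentiable (at x)"
  shows "GDERIV f x :> grad f x"
proof -
  obtain f' where f': "(f has_derivative f') (at x)"
    using assms by (auto simp: differentiable_def)
  have "f' = (\<lambda>h. inner h (adjoint f' 1))"
    using adjoint_works[of f' _ 1] has_derivative_linear[OF f'] by (auto simp: inner_real_def)
  with f' have "GDERIV f x :> adjoint f' 1"
    unfolding gderiv_def by metis
  then show ?thesis
    using grad_eqI by metis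
qed

definition l0norm :: "real^'n \<Rightarrow> nat" where
  "l0norm x = card {i. x $ i \<noteq> 0}"

definition Yset :: "int \<Rightarrow> (real^'n) set" where
  "Yset s = {y. (\<forall>i. y $ i \<in> {0, 1}) \<and> (\<Sum>i\<in>UNIV. y $ i) \<ge> real CARD('n) - real_of_int s}"

definition Xset :: "(real^'n) set \<Rightarrow> real^'n \<Rightarrow> (real^'n) set" where
  "Xset X y = {x \<in> X. \<forall>i. x $ i * y $ i = 0}"

definition feasible :: "(real^'n) set \<Rightarrow> int \<Rightarrow> ((real^'n) \<times> (real^'n)) set" where
  "feasible X s = {(x, y). y \<in> Yset s \<and> x \<in> Xset X y}"

section \<open>Convergence of pairs\<close>

definition pair_converges ::
    "(nat \<Rightarrow> real^'n) \<Rightarrow> (nat \<Rightarrow> real^'n) \<Rightarrow> real^'n \<Rightarrow> real^'n \<Rightarrow> bool" where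
  "pair_converges x y xb yb \<longleftrightarrow>
     x \<longlonglongrightarrow> xb \<and> (\<forall>\<^sub>F k in sequentially. y k = yb)"

definition pair_accumulation_point ::
    "nat set \<Rightarrow> (nat \<Rightarrow> real^'n) \<Rightarrow> (nat \<Rightarrow> real^'n) \<Rightarrow> real^'n \<Rightarrow> real^'n \<Rightarrow> bool" where
  "pair_accumulation_point K x y xb yb \<longleftrightarrow>
     (\<exists>r. strict_mono r \<and> range r \<subseteq> K \<and> pair_converges (x \<circ> r) (y \<circ> r) xb yb)"

section \<open>Discrete neighborhoods\<close>

type_synonym 'n nbhd = "real^'n \<Rightarrow> real^'n \<Rightarrow> ((real^'n) \<times> (real^'n)) set"

definition neighborhood_map :: "(real^'n) set \<Rightarrow> int \<Rightarrow> 'n nbhd \<Rightarrow> bool" where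
  "neighborhood_map X s N \<longleftrightarrow>
     (\<forall>(x, y) \<in> feasible X s. finite (N x y) \<and> N x y \<subseteq> feasible X s \<and> (x, y) \<in> N x y)"

definition nbhd_continuous :: "(real^'n) set \<Rightarrow> int \<Rightarrow> 'n nbhd \<Rightarrow> bool" where
  "nbhd_continuous X s N \<longleftrightarrow>
     (\<forall>x y xb yb. (\<forall>k. (x k, y k) \<in> feasible X s) \<and> pair_converges x y xb yb \<longrightarrow>
        (\<forall>(xh, yh) \<in> N xb yb. \<exists>u v. (\<forall>k. (u k, v k) \<in> N (x k) (y k)) \<and> pair_converges u v xh yh))"

section \<open>Stationarity\<close>

definition stationary :: "(real^'n \<Rightarrow> real) \<Rightarrow> (real^'n) set \<Rightarrow> real^'n \<Rightarrow> bool" where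
  "stationary f C x \<longleftrightarrow> x \<in> C \<and> x = closest_point C (x - grad f x)"

definition N_stationary ::
    "(real^'n \<Rightarrow> real) \<Rightarrow> (real^'n) set \<Rightarrow> int \<Rightarrow> 'n nbhd \<Rightarrow> real^'n \<Rightarrow> bool" where
  "N_stationary f X s N x \<longleftrightarrow>
     x \<in> X \<and> int (l0norm x) \<le> s \<and>
     (\<exists>y \<in> Yset s.
        (x, y) \<in> feasible X s \<and>
        stationary f (Xset X y) x \<and>
        (\<forall>(xh, yh) \<in> N x y. f xh \<ge> f x \<and> (f xh = f x \<longrightarrow> stationary f (Xset X yh) xh)))"

section \<open>The algorithm\<close>

definition pg_dir :: "(real^'n \<Rightarrow> real) \<Rightarrow> (real^'n) set \<Rightarrow> real^'n \<Rightarrow> real^'n" where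
  "pg_dir f C x = closest_point C (x - grad f x) - x"

definition residual :: "(real^'n \<Rightarrow> real) \<Rightarrow> (real^'n) set \<Rightarrow> real^'n \<Rightarrow> real" where
  "residual f C x = norm (x - closest_point C (x - grad f x))"

text \<open>The step size is \<open>\<delta> ^ m\<close> for the least \<open>m\<close> passing the sufficient decrease test; such an
  \<open>m\<close> exists for every \<open>x\<close> in the nonempty closed convex set \<open>C\<close> when \<open>f\<close> is differentiable.\<close>

definition PGLS ::
    "real \<Rightarrow> real \<Rightarrow> (real^'n \<Rightarrow> real) \<Rightarrow> (real^'n) set \<Rightarrow> real^'n \<Rightarrow> real^'n" where
  "PGLS \<gamma> \<delta> f C x =
     (let d = pg_dir f C x;
          m = (LEAST m. f (x + \<delta> ^ m *\<^sub>R d) \<le> f x + \<gamma> * \<delta> ^ m * (grad f x \<bullet> d))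
      in x + \<delta> ^ m *\<^sub>R d)"

text \<open>The loop of Steps 2.2--2.4 on \<open>C = \<X>(y')\<close>, with \<open>x\<close> the current inner iterate, target
  value \<open>t = f(x\<^sub>t) - \<eta>\<^sub>k\<close> and threshold \<open>r = residual(x\<^sup>k) + \<mu>\<^sub>k\<close>. The result is \<open>Some z\<close> if Step
  2.3 accepts the point \<open>z\<close>, and \<open>None\<close> if Step 2.4 discards the neighbor. Being inductive, the
  relation only contains runs that terminate.\<close>

inductive inner_loop ::
    "real \<Rightarrow> real \<Rightarrow> (real^'n \<Rightarrow> real) \<Rightarrow> (real^'n) set \<Rightarrow> real \<Rightarrow> real \<Rightarrow>
     real^'n \<Rightarrow> (real^'n) option \<Rightarrow> bool"
  for \<gamma> \<delta> f C t r where
  accept: "f (PGLS \<gamma> \<delta> f C x) \<le> t \<Longrightarrow> inner_loop \<gamma> \<delta> f C t r x (Some (PGLS \<gamma> \<delta> f C x))"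
| continue: "\<not> f (PGLS \<gamma> \<delta> f C x) \<le> t \<Longrightarrow> residual f C x > r \<Longrightarrow>
    inner_loop \<gamma> \<delta> f C t r (PGLS \<gamma> \<delta> f C x) res \<Longrightarrow> inner_loop \<gamma> \<delta> f C t r x res"
| discard: "\<not> f (PGLS \<gamma> \<delta> f C x) \<le> t \<Longrightarrow> \<not> residual f C x > r \<Longrightarrow>
    inner_loop \<gamma> \<delta> f C t r x None"

text \<open>The whole of Step 2 on the current working set \<open>W\<close>: \<open>Some (z, y')\<close> if some neighbor leads to
  acceptance, \<open>None\<close> if the working set is exhausted and Step 3 is reached. The neighbor is chosen
  arbitrarily, so the relation is nondeterministic.\<close>

inductive nbhd_search ::
    "real \<Rightarrow> real \<Rightarrow> (real^'n \<Rightarrow> real) \<Rightarrow> (real^'n) set \<Rightarrow> real \<Rightarrow> real \<Rightarrow>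
     ((real^'n) \<times> (real^'n)) set \<Rightarrow> ((real^'n) \<times> (real^'n)) option \<Rightarrow> bool"
  for \<gamma> \<delta> f X t r where
  exhausted: "nbhd_search \<gamma> \<delta> f X t r {} None"
| found: "(x', y') \<in> W \<Longrightarrow> inner_loop \<gamma> \<delta> f (Xset X y') t r x' (Some z) \<Longrightarrow>
    nbhd_search \<gamma> \<delta> f X t r W (Some (z, y'))"
| remove: "(x', y') \<in> W \<Longrightarrow> inner_loop \<gamma> \<delta> f (Xset X y') t r x' None \<Longrightarrow>
    nbhd_search \<gamma> \<delta> f X t r (W - {(x', y')}) res \<Longrightarrow> nbhd_search \<gamma> \<delta> f X t r W res"

definition SNS_step ::
    "real \<Rightarrow> real \<Rightarrow> (real^'n \<Rightarrow> real) \<Rightarrow> (real^'n) set \<Rightarrow> 'n nbhd \<Rightarrow> real \<Rightarrow> real \<Rightarrow> real \<Rightarrow>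
     real^'n \<Rightarrow> real^'n \<Rightarrow> real \<Rightarrow> real \<Rightarrow>
     real^'n \<Rightarrow> real^'n \<Rightarrow> real \<Rightarrow> real \<Rightarrow> bool" where
  "SNS_step \<gamma> \<delta> f X N \<xi> \<theta> \<delta>' x y \<eta> \<mu> x1 y1 \<eta>1 \<mu>1 \<longleftrightarrow>
     (let xt = PGLS \<gamma> \<delta> f (Xset X y) x;
          W = {(u, v) \<in> N xt y. f u \<le> f xt + \<xi>}
      in (\<exists>res. nbhd_search \<gamma> \<delta> f X (f xt - \<eta>) (residual f (Xset X y) x + \<mu>) W res \<and>
            (case res of
               Some (z, v) \<Rightarrow> x1 = z \<and> y1 = v \<and> \<eta>1 = \<eta>
             | None \<Rightarrow> x1 = xt \<and> y1 = y \<and>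
                 \<eta>1 = (if f x1 \<le> f x - \<eta> then \<eta> else \<theta> * \<eta>))) \<and>
         \<mu>1 = \<delta>' * \<mu>)"

definition SNS_run ::
    "real \<Rightarrow> real \<Rightarrow> (real^'n \<Rightarrow> real) \<Rightarrow> (real^'n) set \<Rightarrow> 'n nbhd \<Rightarrow> real \<Rightarrow> real \<Rightarrow> real \<Rightarrow>
     (nat \<Rightarrow> real^'n) \<Rightarrow> (nat \<Rightarrow> real^'n) \<Rightarrow> (nat \<Rightarrow> real) \<Rightarrow> (nat \<Rightarrow> real) \<Rightarrow> bool" where
  "SNS_run \<gamma> \<delta> f X N \<xi> \<theta> \<delta>' x y \<eta> \<mu> \<longleftrightarrow>
     (\<forall>k. SNS_step \<gamma> \<delta> f X N \<xi> \<theta> \<delta>' (x k) (y k) (\<eta> k) (\<mu> k)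
            (x (Suc k)) (y (Suc k)) (\<eta> (Suc k)) (\<mu> (Suc k)))"

end

theory Submission
  imports Defs
begin

text \<open>
  A Lipschitz gradient bounds the step sizes of the line search from below uniformly, so one
  projected gradient step from \<open>x\<close> decreases \<open>f\<close> by at least a fixed multiple of the squared
  residual at \<open>x\<close>. Let \<open>k + 1 \<in> K\<^sub>u\<close>. Then \<open>x\<^sup>k\<^sup>+\<^sup>1\<close> is the line search point from \<open>x\<^sup>k\<close>, and every
  neighbor of it in the working set was discarded; in particular the very first line search step
  from such a neighbor missed the target \<open>f(x\<^sup>k\<^sup>+\<^sup>1) - \<eta>\<^sub>k\<close>. Since \<open>f(x\<^sup>k)\<close> decreases and is bounded
  below, and \<open>\<eta>\<^sub>k \<rightarrow> 0\<close>, the residuals at \<open>x\<^sup>k\<close> vanish, which gives stationarity of \<open>x\<^sup>*\<close>. For neighbors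
  converging to a point with function value at most \<open>f(x\<^sup>*)\<close> the missed target forces equality
  of the two values in the limit, hence vanishing residuals at these neighbors as well.
\<close>

section \<open>Descent along projected gradient steps\<close>

lemma mean_value_grad:
  fixes f :: "'a::euclidean_space \<Rightarrow> real"
  assumes "\<forall>z. f differentiable (at z)"
  obtains \<tau> where "0 < \<tau>" "\<tau> < 1" "f (x + h) - f x = grad f (x + \<tau> *\<^sub>R h) \<bullet> h"
proof -
  have deriv: "DERIV (\<lambda>t. f (x + t *\<^sub>R h)) t :> grad f (x + t *\<^sub>R h) \<bullet> h" for t
  proof -
    have "(f has_derivative (\<lambda>v. v \<bullet> grad f (x + t *\<^sub>R h))) (at (x + t *\<^sub>R h))"
      using GDERIV_grad assms unfolding gderiv_def by blast
    moreover have "((\<lambda>t. x + t *\<^sub>R h) has_derivative (\<lambda>u. u *\<^sub>R h)) (at t)"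
      by (auto intro!: derivative_eq_intros)
    ultimately have "((\<lambda>t. f (x + t *\<^sub>R h)) has_derivative (\<lambda>u. (u *\<^sub>R h) \<bullet> grad f (x + t *\<^sub>R h))) (at t)"
      using has_derivative_compose by blast
    then show ?thesis
      by (simp add: has_field_derivative_def inner_commute mult_commute_abs)
  qed
  obtain \<tau> where "0 < \<tau>" "\<tau> < 1"
    "f (x + 1 *\<^sub>R h) - f (x + 0 *\<^sub>R h) = (1 - 0) * (grad f (x + \<tau> *\<^sub>R h) \<bullet> h)"
    using MVT2[of 0 1, OF _ deriv] by auto
  then show thesis
    using that by simp
qed

text \<open>The mean value theorem leaves the gradient at one intermediate point, which differs from
  \<open>grad f x\<close> by at most \<open>L * norm h\<close>. This crude bound gives the constant
  \<open>L\<close> rather than the sharp \<open>L / 2\<close>.\<close>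

lemma lipschitz_grad_upper_bound:
  fixes f :: "'a::euclidean_space \<Rightarrow> real"
  assumes "\<forall>z. f differentiable (at z)" "L-lipschitz_on UNIV (grad f)"
  shows "f (x + h) \<le> f x + grad f x \<bullet> h + L * (norm h)\<^sup>2"
proof -
  obtain \<tau> where \<tau>: "0 < \<tau>" "\<tau> < 1" "f (x + h) - f x = grad f (x + \<tau> *\<^sub>R h) \<bullet> h"
    using mean_value_grad[OF assms(1)] .
  have "0 \<le> L"
    using assms(2) lipschitz_on_nonneg by blast
  have "norm (grad f (x + \<tau> *\<^sub>R h) - grad f x) \<le> L * norm (\<tau> *\<^sub>R h)"
    using lipschitz_onD[OF assms(2), of "x + \<tau> *\<^sub>R h" x] by (simp add: dist_norm)
  also have "\<dots> \<le> L * norm h"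
    using \<tau> \<open>0 \<le> L\<close> by (intro mult_left_mono) (auto intro: mult_left_le_one_le)
  finally have "(grad f (x + \<tau> *\<^sub>R h) - grad f x) \<bullet> h \<le> L * norm h * norm h"
    by (meson mult_right_mono norm_cauchy_schwarz norm_ge_zero order_trans)
  with \<tau>(3) show ?thesis
    by (simp add: inner_diff_left power2_eq_square algebra_simps)
qed

lemma residual_eq_norm_pg_dir: "residual f C x = norm (pg_dir f C x)"
  by (simp add: residual_def pg_dir_def norm_minus_commute)

text \<open>This is the variational inequality of the projection of \<open>x - grad f x\<close>,
  tested at \<open>x\<close> itself.\<close>

lemma grad_inner_pg_dir:
  assumes "closed C" "convex C" "x \<in> C"
  shows "grad f x \<bullet> pg_dir f C x \<le> - (residual f C x)\<^sup>2"
proof -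
  have "(x - grad f x - closest_point C (x - grad f x)) \<bullet> (x - closest_point C (x - grad f x)) \<le> 0"
    using assms by (intro closest_point_dot) auto
  then show ?thesis
    unfolding residual_eq_norm_pg_dir pg_dir_def power2_norm_eq_inner
    by (simp add: inner_diff inner_commute algebra_simps)
qed

lemma tendsto_residual:
  fixes u :: "nat \<Rightarrow> real^'n"
  assumes "closed C" "convex C" "C \<noteq> {}" "continuous_on UNIV (grad f)" "u \<longlonglongrightarrow> a"
  shows "(\<lambda>k. residual f C (u k)) \<longlonglongrightarrow> residual f C a"
proof -
  have "continuous_on UNIV (\<lambda>x. closest_point C (x - grad f x))"
    by (intro continuous_on_compose2[OF continuous_on_closest_point[OF assms(2,1,3), of UNIV]]
        continuous_intros assms(4)) auto
  then have "continuous_on UNIV (residual f C)"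
    unfolding residual_def by (intro continuous_intros)
  then show ?thesis
    using assms(5) continuous_on_tendsto_compose by fastforce
qed

text \<open>The residual is continuous and its zeros in \<open>C\<close> are the stationary points.
  The set \<open>C\<close> is fixed here, so the sequences of pairs must first reach their final
  second component.\<close>

lemma stationary_limit:
  fixes u :: "nat \<Rightarrow> real^'n"
  assumes "closed C" "convex C" "continuous_on UNIV (grad f)" "u \<longlonglongrightarrow> a"
    and "\<forall>\<^sub>F k in sequentially. u k \<in> C" "(\<lambda>k. residual f C (u k)) \<longlonglongrightarrow> 0"
  shows "stationary f C a"
proof -
  have "a \<in> C"
    using Lim_in_closed_set[OF assms(1,5) _ assms(4)] by simp
  moreover have "residual f C a = 0"
    using tendsto_residual[OF assms(1,2) _ assms(3,4)] assms(6) \<open>a \<in> C\<close> LIMSEQ_unique by blast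
  ultimately show ?thesis
    by (simp add: stationary_def residual_def)
qed

text \<open>The bound \<open>m \<le> M\<close> on the exponent of the accepted step size does not depend on \<open>C\<close> or \<open>x\<close>,
  hence neither does the constant \<open>c = \<gamma> * \<delta> ^ M\<close>.\<close>

lemma PGLS_sufficient_decrease:
  fixes f :: "real^'n \<Rightarrow> real"
  assumes "\<forall>z. f differentiable (at z)" "L-lipschitz_on UNIV (grad f)"
    and "0 < \<gamma>" "\<gamma> < 1" "0 < \<delta>" "\<delta> < 1"
  obtains c where "c > 0"
    and "\<And>C x. \<lbrakk>closed C; convex C; x \<in> C\<rbrakk> \<Longrightarrow>
      PGLS \<gamma> \<delta> f C x \<in> C \<and> norm (PGLS \<gamma> \<delta> f C x - x) \<le> residual f C x \<and>
      c * (residual f C x)\<^sup>2 \<le> f x - f (PGLS \<gamma> \<delta> f C x)"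
proof -
  have "(\<lambda>m. \<delta> ^ m * L) \<longlonglongrightarrow> 0 * L"
    using assms by (intro tendsto_mult tendsto_const LIMSEQ_power_zero) auto
  then have "\<forall>\<^sub>F m in sequentially. \<delta> ^ m * L < 1 - \<gamma>"
    using assms(4) by (intro order_tendstoD(2)) auto
  then obtain M where M: "\<delta> ^ M * L < 1 - \<gamma>"
    using eventually_happens trivial_limit_sequentially by blast
  show thesis
  proof
    show "\<gamma> * \<delta> ^ M > 0"
      using assms by simp
  next
    fix C :: "(real^'n) set" and x
    assume C: "closed C" "convex C" "x \<in> C"
    define d where "d = pg_dir f C x"
    define P where "P m \<longleftrightarrow> f (x + \<delta> ^ m *\<^sub>R d) \<le> f x + \<gamma> * \<delta> ^ m * (grad f x \<bullet> d)" for m :: nat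
    define m where "m = (LEAST m. P m)"
    have PGLS: "PGLS \<gamma> \<delta> f C x = x + \<delta> ^ m *\<^sub>R d"
      unfolding PGLS_def d_def m_def P_def by (simp add: Let_def)
    have r: "residual f C x = norm d"
      by (simp add: d_def residual_eq_norm_pg_dir)
    have gd: "grad f x \<bullet> d \<le> - (norm d)\<^sup>2"
      using grad_inner_pg_dir[OF C] r d_def by metis
    \<comment> \<open>By the choice of \<open>M\<close> the quadratic error is at most
      \<open>(1 - \<gamma>) * (norm d)\<^sup>2\<close> times the step size, and the negative linear
      term absorbs this.\<close>
    have "P M"
    proof -
      have "f (x + \<delta> ^ M *\<^sub>R d) \<le> f x + \<delta> ^ M * (grad f x \<bullet> d) + L * (norm (\<delta> ^ M *\<^sub>R d))\<^sup>2"
        using lipschitz_grad_upper_bound[OF assms(1,2), of x "\<delta> ^ M *\<^sub>R d"] by simp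
      moreover have "L * (norm (\<delta> ^ M *\<^sub>R d))\<^sup>2 = \<delta> ^ M * ((\<delta> ^ M * L) * (norm d)\<^sup>2)"
        using assms(5) by (simp add: power_mult_distrib power2_eq_square algebra_simps)
      moreover have "(\<delta> ^ M * L) * (norm d)\<^sup>2 \<le> (1 - \<gamma>) * (norm d)\<^sup>2"
        using M by (intro mult_right_mono) auto
      moreover have "(1 - \<gamma>) * (norm d)\<^sup>2 \<le> (1 - \<gamma>) * (- (grad f x \<bullet> d))"
        using gd assms(4) by (intro mult_left_mono) auto
      ultimately have "f (x + \<delta> ^ M *\<^sub>R d) \<le>
          f x + \<delta> ^ M * (grad f x \<bullet> d) + \<delta> ^ M * ((1 - \<gamma>) * (- (grad f x \<bullet> d)))"
        using assms(5) by (smt (verit) mult_left_mono zero_less_power)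
      then show ?thesis
        unfolding P_def by (simp add: algebra_simps)
    qed
    then have "P m" "m \<le> M"
      unfolding m_def by (auto intro: LeastI Least_le)
    have le1: "\<delta> ^ m \<le> 1" and pos: "0 < \<delta> ^ m"
      using assms by (auto intro: power_le_one)
    \<comment> \<open>A step size of at most 1 makes the new point a convex combination of
      \<open>x\<close> and its projection point.\<close>
    have "closest_point C (x - grad f x) \<in> C"
      using C by (intro closest_point_in_set) auto
    then have "(1 - \<delta> ^ m) *\<^sub>R x + \<delta> ^ m *\<^sub>R closest_point C (x - grad f x) \<in> C"
      using C le1 pos by (intro convexD) auto
    moreover have "PGLS \<gamma> \<delta> f C x = (1 - \<delta> ^ m) *\<^sub>R x + \<delta> ^ m *\<^sub>R closest_point C (x - grad f x)"
      unfolding PGLS d_def pg_dir_def by (simp add: algebra_simps)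
    ultimately have 1: "PGLS \<gamma> \<delta> f C x \<in> C"
      by simp
    have 2: "norm (PGLS \<gamma> \<delta> f C x - x) \<le> residual f C x"
      unfolding PGLS r using le1 pos by (simp add: mult_left_le_one_le)
    have "\<gamma> * \<delta> ^ M * (norm d)\<^sup>2 \<le> \<gamma> * \<delta> ^ m * (norm d)\<^sup>2"
      using assms \<open>m \<le> M\<close> by (intro mult_right_mono mult_left_mono power_decreasing) auto
    also have "\<dots> \<le> \<gamma> * \<delta> ^ m * (- (grad f x \<bullet> d))"
      using assms pos gd by (intro mult_left_mono) auto
    finally have 3: "\<gamma> * \<delta> ^ M * (residual f C x)\<^sup>2 \<le> f x - f (PGLS \<gamma> \<delta> f C x)"
      using \<open>P m\<close> unfolding P_def PGLS r by simp
    show "PGLS \<gamma> \<delta> f C x \<in> C \<and> norm (PGLS \<gamma> \<delta> f C x - x) \<le> residual f C x \<and>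
      \<gamma> * \<delta> ^ M * (residual f C x)\<^sup>2 \<le> f x - f (PGLS \<gamma> \<delta> f C x)"
      using 1 2 3 by blast
  qed
qed

section \<open>Geometry and sparsity of feasible pairs\<close>

lemma closed_Xset:
  fixes X :: "(real^'n) set"
  assumes "closed X"
  shows "closed (Xset X v)"
proof -
  have "Xset X v = X \<inter> (\<Inter>i\<in>{i. v $ i \<noteq> 0}. {x. x $ i = 0})"
    unfolding Xset_def by auto
  then show ?thesis
    using assms by (auto intro!: closed_INT closed_Collect_eq continuous_intros)
qed

lemma convex_Xset:
  assumes "convex X"
  shows "convex (Xset X v)"
proof (rule convexI)
  fix a b and p q :: real
  assume ab: "a \<in> Xset X v" "b \<in> Xset X v" and pq: "0 \<le> p" "0 \<le> q" "p + q = 1"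
  have "(p *\<^sub>R a + q *\<^sub>R b) $ i * v $ i = 0" for i
  proof (cases "v $ i = 0")
    case False
    then have "a $ i = 0" "b $ i = 0"
      using ab by (auto simp: Xset_def)
    then show ?thesis by simp
  qed simp
  moreover have "p *\<^sub>R a + q *\<^sub>R b \<in> X"
    using ab pq assms by (intro convexD) (auto simp: Xset_def)
  ultimately show "p *\<^sub>R a + q *\<^sub>R b \<in> Xset X v"
    by (simp add: Xset_def)
qed

text \<open>Complementarity bounds the 0/1 vector \<open>v\<close> entrywise by the indicator of the
  zeros of \<open>x\<close>, so \<open>x\<close> has at least n - s zeros.\<close>

lemma l0norm_le_of_feasible:
  fixes x v :: "real^'n"
  assumes "(x, v) \<in> feasible X s"
  shows "int (l0norm x) \<le> s"
proof -
  have v01: "v $ i = 0 \<or> v $ i = 1" for i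
    using assms by (auto simp: feasible_def Yset_def)
  have "(\<Sum>i\<in>UNIV. v $ i) \<le> (\<Sum>i\<in>UNIV. if x $ i \<noteq> 0 then 0 else 1)"
  proof (rule sum_mono)
    fix i
    have "x $ i = 0 \<or> v $ i = 0"
      using assms by (simp add: feasible_def Xset_def)
    then show "v $ i \<le> (if x $ i \<noteq> 0 then 0 else 1)"
      using v01[of i] by auto
  qed
  also have "\<dots> = real CARD('n) - real (card {i. x $ i \<noteq> 0})"
  proof -
    have "(\<Sum>i\<in>UNIV. if x $ i \<noteq> 0 then 0 else 1) = (\<Sum>i\<in>UNIV. 1 - (if x $ i \<noteq> 0 then 1 else 0 :: real))"
      by (intro sum.cong) auto
    also have "\<dots> = real CARD('n) - real (card {i. x $ i \<noteq> 0})"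
      by (simp add: sum_subtractf sum.If_cases)
    finally show ?thesis .
  qed
  finally show ?thesis
    using assms by (auto simp: feasible_def Yset_def l0norm_def)
qed

section \<open>Outcomes of the inner loop and of the neighborhood search\<close>

lemma inner_loop_None_first_step:
  assumes "inner_loop \<gamma> \<delta> f C t r u None"
  shows "f (PGLS \<gamma> \<delta> f C u) > t"
  using assms by cases auto

lemma inner_loop_Some:
  assumes "inner_loop \<gamma> \<delta> f C t r u res" "res = Some z" "u \<in> C"
    and "\<And>w. w \<in> C \<Longrightarrow> PGLS \<gamma> \<delta> f C w \<in> C"
  shows "z \<in> C \<and> f z \<le> t"
  using assms by induction auto

text \<open>An exhausted search has removed every pair, in whatever order, and the inner loop run on
  a pair does not depend on what remains in \<open>W\<close>.\<close>

lemma nbhd_search_None: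
  assumes "nbhd_search \<gamma> \<delta> f X t r W res" "res = None" "(u, v) \<in> W"
  shows "inner_loop \<gamma> \<delta> f (Xset X v) t r u None"
  using assms by induction blast+

lemma nbhd_search_Some:
  assumes "nbhd_search \<gamma> \<delta> f X t r W res" "res = Some (z, v)"
  shows "\<exists>u. (u, v) \<in> W \<and> inner_loop \<gamma> \<delta> f (Xset X v) t r u (Some z)"
  using assms by induction auto

theorem theorem3p9:
  fixes f :: "real^'n \<Rightarrow> real"
    and X :: "(real^'n) set"
    and N :: "'n nbhd"
    and s :: int
    and x y :: "nat \<Rightarrow> real^'n"
    and \<eta> \<mu> :: "nat \<Rightarrow> real"
    and \<gamma> \<delta> \<xi> \<theta> \<delta>' \<eta>\<^sub>0 \<mu>\<^sub>0 L :: real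
    and x\<^sub>0 y\<^sub>0 xs ys :: "real^'n"
  assumes "s < int CARD('n)"
    and "closed X" and "convex X"
    and "\<forall>z. f differentiable (at z)"
    and "continuous_on UNIV (grad f)"
    and "L-lipschitz_on UNIV (grad f)"
    and "neighborhood_map X s N"
    and "nbhd_continuous X s N"
    and "0 < \<gamma>" and "\<gamma> < 1 / 2"
    and "0 < \<delta>" and "\<delta> < 1"
    and "\<xi> > 0"
    and "0 < \<theta>" and "\<theta> < 1"
    and "\<eta>\<^sub>0 > 0" and "\<mu>\<^sub>0 > 0"
    and "0 < \<delta>'" and "\<delta>' < 1"
    and "y\<^sub>0 \<in> Yset s" and "x\<^sub>0 \<in> Xset X y\<^sub>0"
    and "x 0 = x\<^sub>0" and "y 0 = y\<^sub>0" and "\<eta> 0 = \<eta>\<^sub>0" and "\<mu> 0 = \<mu>\<^sub>0"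
    and "SNS_run \<gamma> \<delta> f X N \<xi> \<theta> \<delta>' x y \<eta> \<mu>"
    and "compact {(u, v). v \<in> Yset s \<and> u \<in> Xset X v \<and> f u \<le> f x\<^sub>0 + \<xi>}"
    and "pair_accumulation_point {k. k \<ge> 1 \<and> \<eta> k < \<eta> (k - 1)} x y xs ys"
  shows "N_stationary f X s N xs"
proof -
  note diff = assms(4) and cont = assms(5)
  have clo: "closed (Xset X v)" and conv: "convex (Xset X v)" for v
    using assms(2,3) closed_Xset convex_Xset by blast+
  obtain c where "c > 0" and PGLS: "\<And>C u. \<lbrakk>closed C; convex C; u \<in> C\<rbrakk> \<Longrightarrow>
      PGLS \<gamma> \<delta> f C u \<in> C \<and> norm (PGLS \<gamma> \<delta> f C u - u) \<le> residual f C u \<and>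
      c * (residual f C u)\<^sup>2 \<le> f u - f (PGLS \<gamma> \<delta> f C u)"
    using PGLS_sufficient_decrease[OF diff assms(6,9) _ assms(11,12)] assms(10)
    by (smt (verit) field_sum_of_halves)
  define xt where "xt k = PGLS \<gamma> \<delta> f (Xset X (y k)) (x k)" for k
  define rho where "rho k = residual f (Xset X (y k)) (x k)" for k
  have xt: "xt k \<in> Xset X (y k)" "norm (xt k - x k) \<le> rho k" "c * (rho k)\<^sup>2 \<le> f (x k) - f (xt k)"
    if "x k \<in> Xset X (y k)" for k
    unfolding xt_def rho_def using PGLS[OF clo conv that] by blast+
  have xt_le: "f (xt k) \<le> f (x k)" if "x k \<in> Xset X (y k)" for k
    using xt(3)[OF that] \<open>c > 0\<close> by (smt (verit) mult_nonneg_nonneg zero_le_power2)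

  \<comment> \<open>One iteration as two alternatives: acceptance in Step 2.3, or Step 3 after all
    neighbors were discarded. Of each discarded run only the first failed test is kept, and the test
    of Step 3 is weakened to its two possible outcomes.\<close>
  have step: "(\<exists>u z. (u, y (Suc k)) \<in> N (xt k) (y k) \<and>
        inner_loop \<gamma> \<delta> f (Xset X (y (Suc k))) (f (xt k) - \<eta> k) (rho k + \<mu> k) u (Some z) \<and>
        x (Suc k) = z \<and> \<eta> (Suc k) = \<eta> k) \<or>
      (\<forall>(u, v) \<in> N (xt k) (y k). f u \<le> f (xt k) + \<xi> \<longrightarrow>
          f (PGLS \<gamma> \<delta> f (Xset X v) u) > f (xt k) - \<eta> k) \<and>
        x (Suc k) = xt k \<and> y (Suc k) = y k \<and> (\<eta> (Suc k) = \<eta> k \<or> \<eta> (Suc k) = \<theta> * \<eta> k)" for k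
  proof -
    have "SNS_step \<gamma> \<delta> f X N \<xi> \<theta> \<delta>' (x k) (y k) (\<eta> k) (\<mu> k)
        (x (Suc k)) (y (Suc k)) (\<eta> (Suc k)) (\<mu> (Suc k))"
      using assms(26) unfolding SNS_run_def by blast
    then obtain res where res:
        "nbhd_search \<gamma> \<delta> f X (f (xt k) - \<eta> k) (rho k + \<mu> k) {(u, v) \<in> N (xt k) (y k). f u \<le> f (xt k) + \<xi>} res"
        "case res of Some (z, v) \<Rightarrow> x (Suc k) = z \<and> y (Suc k) = v \<and> \<eta> (Suc k) = \<eta> k
         | None \<Rightarrow> x (Suc k) = xt k \<and> y (Suc k) = y k \<and>
             \<eta> (Suc k) = (if f (x (Suc k)) \<le> f (x k) - \<eta> k then \<eta> k else \<theta> * \<eta> k)"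
      unfolding SNS_step_def xt_def rho_def by (auto simp: Let_def)
    show ?thesis
    proof (cases res)
      case None
      have "f (PGLS \<gamma> \<delta> f (Xset X v) u) > f (xt k) - \<eta> k"
        if "(u, v) \<in> N (xt k) (y k)" "f u \<le> f (xt k) + \<xi>" for u v
        using nbhd_search_None[OF res(1) None] that by (blast intro: inner_loop_None_first_step)
      then show ?thesis
        using res(2) None by (auto split: if_splits)
    next
      case (Some p)
      then obtain z v where "res = Some (z, v)"
        by (cases p) auto
      then show ?thesis
        using nbhd_search_Some[OF res(1)] res(2) by fastforce
    qed
  qed

  \<comment> \<open>Feasibility and descent of the iterates\<close>
  have eta_pos: "\<eta> k > 0" for k
  proof (induction k)
    case 0
    then show ?case using assms(16,24) by simp
  next
    case (Suc k)
    then show ?case using step[of k] assms(14) by auto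
  qed
  have eta_le: "\<eta> (Suc k) \<le> \<eta> k" for k
    using step[of k] eta_pos[of k] assms(14,15) mult_left_le_one_le[of "\<eta> k" \<theta>] by auto

  have N_feas: "N u v \<subseteq> feasible X s" if "(u, v) \<in> feasible X s" for u v
    using assms(7) that unfolding neighborhood_map_def by blast
  have feas_Suc: "(x (Suc k), y (Suc k)) \<in> feasible X s \<and> f (x (Suc k)) \<le> f (xt k)"
    if feas: "(x k, y k) \<in> feasible X s" for k
  proof -
    have xt_feas: "(xt k, y k) \<in> feasible X s"
      using feas xt(1) by (auto simp: feasible_def)
    from step[of k] show ?thesis
    proof (elim disjE exE conjE)
      fix u z
      assume u: "(u, y (Suc k)) \<in> N (xt k) (y k)"
        and loop: "inner_loop \<gamma> \<delta> f (Xset X (y (Suc k))) (f (xt k) - \<eta> k) (rho k + \<mu> k) u (Some z)"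
        and z: "x (Suc k) = z"
      have "(u, y (Suc k)) \<in> feasible X s"
        using u N_feas[OF xt_feas] by blast
      moreover from this have "z \<in> Xset X (y (Suc k)) \<and> f z \<le> f (xt k) - \<eta> k"
        using inner_loop_Some[OF loop refl] PGLS[OF clo conv] by (auto simp: feasible_def)
      ultimately show ?thesis
        using z eta_pos[of k] by (auto simp: feasible_def)
    qed (use xt_feas in auto)
  qed
  have feas: "(x k, y k) \<in> feasible X s" for k
    using assms(20-23) feas_Suc by (induction k) (auto simp: feasible_def)
  then have x_in: "x k \<in> Xset X (y k)" for k
    by (auto simp: feasible_def)
  have f_xt: "f (x (Suc k)) \<le> f (xt k)" for k
    using feas_Suc feas by blast
  have decr: "decseq (\<lambda>k. f (x k))"
    using f_xt xt_le[OF x_in] by (intro decseq_SucI) (meson order_trans)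
  have contf: "continuous_on UNIV f"
    using diff by (simp add: continuous_at_imp_continuous_on differentiable_imp_continuous_within)

  \<comment> \<open>Convergence of the function values and of the residuals\<close>
  define Lev where "Lev = {(u, v). v \<in> Yset s \<and> u \<in> Xset X v \<and> f u \<le> f x\<^sub>0 + \<xi>}"
  have "compact ((\<lambda>p. f (fst p)) ` Lev)"
    using assms(27) unfolding Lev_def
    by (intro compact_continuous_image continuous_on_compose2[OF contf] continuous_intros) auto
  then have "bdd_below ((\<lambda>p. f (fst p)) ` Lev)"
    by (intro bounded_imp_bdd_below compact_imp_bounded)
  moreover have "f (x k) \<in> (\<lambda>p. f (fst p)) ` Lev" for k
  proof -
    have "f (x k) \<le> f x\<^sub>0"
      using decseqD[OF decr, of 0 k] assms(22) by simp
    then have "(x k, y k) \<in> Lev"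
      using feas[of k] assms(13) by (auto simp: Lev_def feasible_def)
    then show ?thesis
      by force
  qed
  ultimately have "\<exists>B. \<forall>k. B \<le> f (x k)"
    unfolding bdd_below_def by blast
  then obtain l where l: "(\<lambda>k. f (x k)) \<longlonglongrightarrow> l"
    using decseq_convergent[OF decr] by metis

  \<comment> \<open>Used twice: for the residuals at the iterates and for those at the
    neighbors.\<close>
  have vanish: "g \<longlonglongrightarrow> 0"
    if "\<And>k. c * (g k)\<^sup>2 \<le> h k" "h \<longlonglongrightarrow> 0" for g h :: "nat \<Rightarrow> real"
  proof -
    have "(\<lambda>k. (g k)\<^sup>2) \<longlonglongrightarrow> 0"
    proof (rule tendsto_sandwich[OF _ _ tendsto_const])
      show "(\<lambda>k. h k / c) \<longlonglongrightarrow> 0"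
        using tendsto_divide[OF that(2) tendsto_const, of c] \<open>c > 0\<close> by simp
    qed (use that(1) \<open>c > 0\<close> in \<open>auto simp: field_simps\<close>)
    then show ?thesis
      by simp
  qed

  \<comment> \<open>The decrease per iteration dominates the squared residual, and consecutive
    differences of the convergent values \<open>f (x k)\<close> tend to 0.\<close>
  have rho: "rho \<longlonglongrightarrow> 0"
  proof (rule vanish)
    show "c * (rho k)\<^sup>2 \<le> f (x k) - f (x (Suc k))" for k
      using xt(3)[OF x_in] f_xt[of k] by (smt (verit))
    show "(\<lambda>k. f (x k) - f (x (Suc k))) \<longlonglongrightarrow> 0"
      using tendsto_diff[OF l LIMSEQ_Suc[OF l]] by simp
  qed

  \<comment> \<open>Passage to the accumulation point\<close>
  obtain r where r: "strict_mono r" "range r \<subseteq> {k. k \<ge> 1 \<and> \<eta> k < \<eta> (k - 1)}"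
      "(\<lambda>j. x (r j)) \<longlonglongrightarrow> xs" "\<forall>\<^sub>F j in sequentially. y (r j) = ys"
    using assms(28) unfolding pair_accumulation_point_def pair_converges_def by (auto simp: o_def)
  \<comment> \<open>The iteration that shrinks \<eta> is the one before the index in K_u. The
    natural subtraction is exact because \<open>r j \<ge> 1\<close>.\<close>
  define p where "p j = r j - 1" for j
  have r_K: "r j \<ge> 1" "\<eta> (r j) < \<eta> (r j - 1)" for j
    using r(2) by blast+
  have r_p: "r j = Suc (p j)" and eta_p: "\<eta> (Suc (p j)) < \<eta> (p j)" for j
    using r_K[of j] by (simp_all add: p_def)
  have p_mono: "strict_mono p"
    using r(1) r_p by (simp add: strict_mono_def)
  \<comment> \<open>A strict decrease of \<eta> rules out the acceptance alternative of
    \<open>step\<close>.\<close>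
  have fail: "f (PGLS \<gamma> \<delta> f (Xset X v) u) > f (x (r j)) - \<eta> (p j)"
    if "(u, v) \<in> N (x (r j)) (y (r j))" "f u \<le> f (x (r j)) + \<xi>" for j u v
    using step[of "p j"] eta_p[of j] that unfolding r_p by auto
  have at_p: "x (r j) = xt (p j)" "y (r j) = y (p j)" "\<eta> (r j) = \<theta> * \<eta> (p j)" for j
    using step[of "p j"] eta_p[of j] unfolding r_p by auto

  \<comment> \<open>Every iteration \<open>p j\<close> multiplies \<eta> by \<theta>, and \<eta>
    never grows in between.\<close>
  have eta_geom: "\<eta> (p j) \<le> \<theta> ^ j * \<eta> 0" for j
  proof (induction j)
    case 0
    then show ?case using lift_Suc_antimono_le[of \<eta>, OF eta_le] by simp
  next
    case (Suc j)
    have "\<eta> (p (Suc j)) \<le> \<eta> (r j)"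
      using strict_monoD[OF p_mono, of j "Suc j"]
      by (intro lift_Suc_antimono_le[of \<eta>, OF eta_le]) (simp add: r_p)
    also have "\<dots> \<le> \<theta> * (\<theta> ^ j * \<eta> 0)"
      unfolding at_p using Suc assms(14) by (intro mult_left_mono) auto
    finally show ?case by (simp add: algebra_simps)
  qed
  have geom0: "(\<lambda>j. \<theta> ^ j * \<eta> 0) \<longlonglongrightarrow> 0"
    using assms(14,15) by (intro tendsto_mult_left_zero LIMSEQ_power_zero) auto
  have eta0: "(\<lambda>j. \<eta> (p j)) \<longlonglongrightarrow> 0"
    using eta_geom eta_pos
    by (intro tendsto_sandwich[OF _ _ tendsto_const geom0]) (simp_all add: less_imp_le)

  have rho_p: "(\<lambda>j. rho (p j)) \<longlonglongrightarrow> 0"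
    using LIMSEQ_subseq_LIMSEQ[OF rho p_mono] by (simp add: o_def)
  have "(\<lambda>j. x (r j) - x (p j)) \<longlonglongrightarrow> 0"
    using xt(2)[OF x_in] unfolding at_p by (intro Lim_null_comparison[OF _ rho_p]) auto
  \<comment> \<open>The small residuals are known at \<open>x (p j)\<close>, not at
    \<open>x (r j)\<close>. The two points are one line search step apart, of length at most
    \<open>rho (p j)\<close>, so they share the limit.\<close>
  from tendsto_diff[OF r(3) this] have x_p: "(\<lambda>j. x (p j)) \<longlonglongrightarrow> xs"
    by simp
  have y_p: "\<forall>\<^sub>F j in sequentially. y (p j) = ys"
    using r(4) unfolding at_p .
  have stat: "stationary f (Xset X ys) xs"
  proof (rule stationary_limit[OF clo conv cont x_p])
    show "\<forall>\<^sub>F j in sequentially. x (p j) \<in> Xset X ys"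
      using y_p by eventually_elim (use x_in in auto)
    show "(\<lambda>j. residual f (Xset X ys) (x (p j))) \<longlonglongrightarrow> 0"
      by (rule Lim_transform_eventually[OF rho_p])
        (use y_p in eventually_elim, auto simp: rho_def)
  qed
  then have "xs \<in> Xset X ys"
    by (simp add: stationary_def)
  moreover have "ys \<in> Yset s"
  proof -
    from y_p obtain j where "y (p j) = ys"
      using eventually_happens trivial_limit_sequentially by blast
    then show ?thesis
      using feas[of "p j"] by (auto simp: feasible_def)
  qed
  ultimately have feas_lim: "(xs, ys) \<in> feasible X s"
    by (simp add: feasible_def)

  \<comment> \<open>Neighbors of the limit point\<close>
  have f_r: "(\<lambda>j. f (x (r j))) \<longlonglongrightarrow> f xs"
    using continuous_on_tendsto_compose[OF contf r(3)] by simp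
  have nbhd: "f xs \<le> f xh \<and> (f xh = f xs \<longrightarrow> stationary f (Xset X yh) xh)"
    if xh_in: "(xh, yh) \<in> N xs ys" for xh yh
  proof (cases "f xh \<le> f xs")
    case True
    have "pair_converges (\<lambda>j. x (r j)) (\<lambda>j. y (r j)) xs ys"
      using r(3,4) by (simp add: pair_converges_def)
    then obtain u v where uv: "\<And>j. (u j, v j) \<in> N (x (r j)) (y (r j))" and "pair_converges u v xh yh"
      using assms(8)[unfolded nbhd_continuous_def, rule_format,
          of "\<lambda>j. x (r j)" "\<lambda>j. y (r j)" xs ys "(xh, yh)"] feas xh_in by auto
    then have u: "u \<longlonglongrightarrow> xh" and v: "\<forall>\<^sub>F j in sequentially. v j = yh"
      by (simp_all add: pair_converges_def)
    have u_in: "u j \<in> Xset X (v j)" for j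
      using uv[of j] N_feas[OF feas, of "r j"] by (auto simp: feasible_def)
    have f_u: "(\<lambda>j. f (u j)) \<longlonglongrightarrow> f xh"
      using continuous_on_tendsto_compose[OF contf u] by simp
    have "\<forall>\<^sub>F j in sequentially. f (u j) - f (x (r j)) < \<xi>"
      using order_tendstoD(2)[OF tendsto_diff[OF f_u f_r], of \<xi>] True assms(13) by simp
    \<comment> \<open>The difference just bounded has limit
      \<open>f xh - f xs \<le> 0 < \<xi>\<close>, so the neighbors eventually lie in the working set
      and \<open>fail\<close> applies. Their line search decrease is then smaller than the gap to
      the missed target.\<close>
    then have res: "\<forall>\<^sub>F j in sequentially.
        c * (residual f (Xset X (v j)) (u j))\<^sup>2 \<le> f (u j) - (f (x (r j)) - \<eta> (p j))"
    proof eventually_elim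
      case (elim j)
      then have "f (PGLS \<gamma> \<delta> f (Xset X (v j)) (u j)) > f (x (r j)) - \<eta> (p j)"
        using fail[OF uv] by simp
      then show ?case
        using PGLS[OF clo conv u_in[of j]] by linarith
    qed
    have gap: "(\<lambda>j. f (u j) - (f (x (r j)) - \<eta> (p j))) \<longlonglongrightarrow> f xh - f xs"
      using tendsto_diff[OF f_u tendsto_diff[OF f_r eta0]] by simp
    \<comment> \<open>The gap eventually dominates a square, so its limit cannot be negative; with
      the case assumption this forces equality.\<close>
    have "0 \<le> f xh - f xs"
    proof (rule tendsto_lowerbound[OF gap])
      show "\<forall>\<^sub>F j in sequentially. 0 \<le> f (u j) - (f (x (r j)) - \<eta> (p j))"
        using res
      proof eventually_elim
        case (elim j)
        have "0 \<le> c * (residual f (Xset X (v j)) (u j))\<^sup>2"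
          using \<open>c > 0\<close> by simp
        then show ?case
          using elim by linarith
      qed
    qed simp
    then have eq: "f xh = f xs"
      using True by simp
    \<comment> \<open>\<open>vanish\<close> asks for its bound at every index, hence the shift by
      \<open>j0\<close>, past which also \<open>v j = yh\<close>.\<close>
    obtain j0 where j0: "\<And>j. j \<ge> j0 \<Longrightarrow>
        c * (residual f (Xset X (v j)) (u j))\<^sup>2 \<le> f (u j) - (f (x (r j)) - \<eta> (p j)) \<and> v j = yh"
      using eventually_conj[OF res v] unfolding eventually_sequentially by blast
    have "stationary f (Xset X yh) xh"
    proof (rule stationary_limit[OF clo conv cont LIMSEQ_ignore_initial_segment[OF u, of j0]])
      show "\<forall>\<^sub>F j in sequentially. u (j + j0) \<in> Xset X yh"
      proof (rule always_eventually, rule allI)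
        fix j
        show "u (j + j0) \<in> Xset X yh"
          using u_in[of "j + j0"] j0[of "j + j0"] by simp
      qed
      show "(\<lambda>j. residual f (Xset X yh) (u (j + j0))) \<longlonglongrightarrow> 0"
      proof (rule vanish)
        show "c * (residual f (Xset X yh) (u (j + j0)))\<^sup>2
            \<le> f (u (j + j0)) - (f (x (r (j + j0))) - \<eta> (p (j + j0)))" for j
          using j0[of "j + j0"] by auto
        show "(\<lambda>j. f (u (j + j0)) - (f (x (r (j + j0))) - \<eta> (p (j + j0)))) \<longlonglongrightarrow> 0"
          using LIMSEQ_ignore_initial_segment[OF gap, of j0] eq by simp
      qed
    qed
    with eq show ?thesis by simp
  qed auto

  show ?thesis
    unfolding N_stationary_def
    using feas_lim stat nbhd l0norm_le_of_feasible[OF feas_lim]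
    by (auto simp: feasible_def Xset_def intro!: bexI[of _ ys])
qed

end
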